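(* Let $I \subseteq \mathbb{R}$ be an interval with interior $I^{\circ}$, let $f: I \to \mathbb{R}$ be three times differentiable on $I^{\circ}$, let $a,b \in I^{\circ}$ with $a<b$, and suppose $f''' \in L[a,b]$. Let $q\ge 1$. If $|f'''|^{q}$ is quasi-convex on $[a,b]$, then $$\left| f\left(\frac{a+b}{2}\right) - \frac{1}{b-a}\int_a^b f(x)\,dx + \frac{b-a}{24}\,[f'(b)-f'(a)] \right| \le \frac{(b-a)^3}{192}\left(\max\{|f'''(a)|^q,|f'''(b)|^q\}\right)^{\frac1q}.$$
   Context: A function $g:[a,b]\to\mathbb{R}$ is called quasi-convex on $[a,b]$ if $g(\lambda x+(1-\lambda)y)\le \max\{g(x),g(y)\}$ for all $x,y\in[a,b]$ and all $\lambda\in[0,1]$. $L[a,b]$ denotes the Lebesgue integrable functions on $[a,b]$. *)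

theory Defs
  imports "HOL-Analysis.Analysis"
begin

definition quasi_convex_on :: "real set \<Rightarrow> (real \<Rightarrow> real) \<Rightarrow> bool" where
  "quasi_convex_on S g \<longleftrightarrow>
     (\<forall>x\<in>S. \<forall>y\<in>S. \<forall>t\<in>{0..1}. g (t * x + (1 - t) * y) \<le> max (g x) (g y))"

end

theory Submission
  imports Defs
begin

text \<open>
  Let \<open>m\<close> be the midpoint, \<open>F\<close> an antiderivative of \<open>f\<close>, and consider
  \<open>\<phi> t = 2 t f m - (F (m + t) - F (m - t)) + (t\<^sup>2 / 6) (f' (m + t) - f' (m - t))\<close>,
  which at \<open>t = (b - a) / 2\<close> is \<open>b - a\<close> times the quantity to be estimated.
  Quasi-convexity bounds \<open>\<bar>f'''\<bar>\<close> by a constant \<open>M\<close>, and then \<open>\<bar>\<phi>'' t\<bar> \<le> M t\<^sup>2\<close>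
  with \<open>\<phi> 0 = \<phi>' 0 = 0\<close>; integrating twice gives \<open>\<bar>\<phi> t\<bar> \<le> M t ^ 4 / 12\<close>.
\<close>

text \<open>Both \<open>v - u\<close> and \<open>v + u\<close> have nonnegative derivative and start
  at 0, so neither is negative at \<open>h\<close>. Derivatives are asked for only in the open
  interval because an indefinite integral is in general not two-sidedly differentiable at the
  ends.\<close>

lemma abs_le_of_abs_deriv_le:
  fixes u v u' v' :: "real \<Rightarrow> real"
  assumes "0 \<le> h"
    and "continuous_on {0..h} u" "continuous_on {0..h} v"
    and du: "\<And>t. 0 < t \<Longrightarrow> t < h \<Longrightarrow> (u has_real_derivative u' t) (at t)"
    and dv: "\<And>t. 0 < t \<Longrightarrow> t < h \<Longrightarrow> (v has_real_derivative v' t) (at t)"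
    and le: "\<And>t. 0 < t \<Longrightarrow> t < h \<Longrightarrow> \<bar>u' t\<bar> \<le> v' t"
    and "u 0 = 0" "v 0 = 0"
  shows "\<bar>u h\<bar> \<le> v h"
proof -
  have "v 0 - u 0 \<le> v h - u h"
  proof (rule DERIV_nonneg_imp_increasing_open[OF \<open>0 \<le> h\<close>])
    fix t :: real assume t: "0 < t" "t < h"
    show "\<exists>y. ((\<lambda>t. v t - u t) has_real_derivative y) (at t) \<and> 0 \<le> y"
      using le[OF t] DERIV_diff[OF dv[OF t] du[OF t]] by (intro exI conjI) (assumption, linarith)
  qed (intro continuous_intros assms)
  moreover have "v 0 + u 0 \<le> v h + u h"
  proof (rule DERIV_nonneg_imp_increasing_open[OF \<open>0 \<le> h\<close>])
    fix t :: real assume t: "0 < t" "t < h"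
    show "\<exists>y. ((\<lambda>t. v t + u t) has_real_derivative y) (at t) \<and> 0 \<le> y"
      using le[OF t] DERIV_add[OF dv[OF t] du[OF t]] by (intro exI conjI) (assumption, linarith)
  qed (intro continuous_intros assms)
  ultimately show ?thesis using assms by linarith
qed

text \<open>Three rounds of the comparison lemma, for \<open>?w\<close>, \<open>?\<phi>1\<close> and
  \<open>?\<phi>\<close> in turn. Only the pointwise bound \<open>M\<close> on \<open>f3\<close>
  enters; \<open>f3\<close> is never integrated.\<close>

lemma midpoint_remainder_bound:
  fixes F f f1 f2 f3 :: "real \<Rightarrow> real"
  assumes "0 \<le> h"
    and cF: "continuous_on {m - h..m + h} F"
    and dF: "\<And>x. m - h < x \<Longrightarrow> x < m + h \<Longrightarrow> (F has_real_derivative f x) (at x)"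
    and d0: "\<And>x. x \<in> {m - h..m + h} \<Longrightarrow> (f has_real_derivative f1 x) (at x)"
    and d1: "\<And>x. x \<in> {m - h..m + h} \<Longrightarrow> (f1 has_real_derivative f2 x) (at x)"
    and d2: "\<And>x. x \<in> {m - h..m + h} \<Longrightarrow> (f2 has_real_derivative f3 x) (at x)"
    and M: "\<And>x. x \<in> {m - h..m + h} \<Longrightarrow> \<bar>f3 x\<bar> \<le> M"
  shows "\<bar>2 * h * f m - (F (m + h) - F (m - h)) + h\<^sup>2 / 6 * (f1 (m + h) - f1 (m - h))\<bar>
    \<le> M * h ^ 4 / 12"
proof -
  have c: "continuous_on {m - h..m + h} f" "continuous_on {m - h..m + h} f1"
    "continuous_on {m - h..m + h} f2"
    using d0 d1 d2 by (blast intro: DERIV_continuous_on has_field_derivative_at_within)+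
  have shift: "continuous_on {0..t} (\<lambda>s. g (m + s))" "continuous_on {0..t} (\<lambda>s. g (m - s))"
    if "continuous_on {m - h..m + h} g" "t \<le> h" for g :: "real \<Rightarrow> real" and t
    by (rule continuous_on_compose2[OF that(1)], use that(2) in \<open>auto intro!: continuous_intros\<close>)+
  note cont = shift[OF cF] shift[OF c(1)] shift[OF c(2)] shift[OF c(3)]
  have reflect: "((\<lambda>s. g (m + s)) has_real_derivative g' (m + t)) (at t)"
    "((\<lambda>s. g (m - s)) has_real_derivative - g' (m - t)) (at t)"
    if "(g has_real_derivative g' (m + t)) (at (m + t))"
      "(g has_real_derivative g' (m - t)) (at (m - t))" for g g' :: "real \<Rightarrow> real" and t
  proof -
    have "((\<lambda>s. m + s) has_real_derivative 1) (at t)" "((\<lambda>s. m - s) has_real_derivative - 1) (at t)"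
      by (auto intro!: derivative_eq_intros)
    from DERIV_chain2[where f = g, OF that(1) this(1)] DERIV_chain2[where f = g, OF that(2) this(2)]
    show "((\<lambda>s. g (m + s)) has_real_derivative g' (m + t)) (at t)"
      "((\<lambda>s. g (m - s)) has_real_derivative - g' (m - t)) (at t)"
      by simp_all
  qed
  have Df: "((\<lambda>s. f (m + s)) has_real_derivative f1 (m + t)) (at t)"
    "((\<lambda>s. f (m - s)) has_real_derivative - f1 (m - t)) (at t)"
    "((\<lambda>s. f1 (m + s)) has_real_derivative f2 (m + t)) (at t)"
    "((\<lambda>s. f1 (m - s)) has_real_derivative - f2 (m - t)) (at t)"
    "((\<lambda>s. f2 (m + s)) has_real_derivative f3 (m + t)) (at t)"
    "((\<lambda>s. f2 (m - s)) has_real_derivative - f3 (m - t)) (at t)"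
    "((\<lambda>s. F (m + s)) has_real_derivative f (m + t)) (at t)"
    "((\<lambda>s. F (m - s)) has_real_derivative - f (m - t)) (at t)"
    if "0 < t" "t < h" for t
    by (intro reflect d0 d1 d2 dF; use that in auto)+
  have third: "\<bar>f3 (m + t) - f3 (m - t)\<bar> \<le> 2 * M" if "0 < t" "t < h" for t
    using M[of "m + t"] M[of "m - t"] that by (auto simp: abs_le_iff)
  \<comment> \<open>This is the trapezoidal error of \<open>f2\<close> on the interval from
    \<open>m - t\<close> to \<open>m + t\<close>. On differentiating, the \<open>f2\<close> terms
    cancel and \<open>t * (f3 (m + t) - f3 (m - t))\<close> remains, of size at most
    \<open>2 * M * t\<close>.\<close>
  let ?w = "\<lambda>t. t * (f2 (m + t) + f2 (m - t)) - (f1 (m + t) - f1 (m - t))"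
  let ?\<phi>1 = "\<lambda>t. 2 * f m - f (m + t) - f (m - t) + t / 3 * (f1 (m + t) - f1 (m - t))
    + t\<^sup>2 / 6 * (f2 (m + t) + f2 (m - t))"
  let ?\<phi> = "\<lambda>t. 2 * t * f m - (F (m + t) - F (m - t)) + t\<^sup>2 / 6 * (f1 (m + t) - f1 (m - t))"
  have w: "\<bar>?w t\<bar> \<le> M * t\<^sup>2" if t: "0 < t" "t < h" for t
  proof (rule abs_le_of_abs_deriv_le[where u = ?w and v = "\<lambda>t. M * t\<^sup>2"])
    fix s assume s: "0 < s" "s < t"
    then have s': "0 < s" "s < h" using t by auto
    show "(?w has_real_derivative s * (f3 (m + s) - f3 (m - s))) (at s)"
      by (rule derivative_eq_intros Df[OF s'] refl | simp add: algebra_simps)+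
    show "((\<lambda>t. M * t\<^sup>2) has_real_derivative 2 * M * s) (at s)"
      by (auto intro!: derivative_eq_intros)
    show "\<bar>s * (f3 (m + s) - f3 (m - s))\<bar> \<le> 2 * M * s"
      using mult_left_mono[OF third[OF s'], of s] s by (simp add: abs_mult mult_ac)
  qed (use t in \<open>auto intro!: continuous_intros cont\<close>)
  have \<phi>1: "\<bar>?\<phi>1 t\<bar> \<le> M * t ^ 3 / 3" if t: "0 < t" "t < h" for t
  proof (rule abs_le_of_abs_deriv_le[where u = ?\<phi>1 and v = "\<lambda>t. M * t ^ 3 / 3"])
    fix s assume s: "0 < s" "s < t"
    then have s': "0 < s" "s < h" using t by auto
    \<comment> \<open>The second derivative of \<open>?\<phi>\<close>, with its \<open>f1\<close>
      and \<open>f2\<close> terms collected into \<open>?w\<close>. The two summands contribute 2/3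
      and 1/3 of \<open>M * s\<^sup>2\<close>.\<close>
    let ?d = "2 / 3 * ?w s + s\<^sup>2 / 6 * (f3 (m + s) - f3 (m - s))"
    show "(?\<phi>1 has_real_derivative ?d) (at s)"
      by (rule derivative_eq_intros Df[OF s'] refl | simp add: field_simps)+
    show "((\<lambda>t. M * t ^ 3 / 3) has_real_derivative M * s\<^sup>2) (at s)"
      by (auto intro!: derivative_eq_intros)
    have "\<bar>s\<^sup>2 / 6 * (f3 (m + s) - f3 (m - s))\<bar> \<le> M * s\<^sup>2 / 3"
      using mult_left_mono[OF third[OF s'], of "s\<^sup>2 / 6"] by (simp add: abs_mult mult_ac)
    moreover have "\<bar>2 / 3 * x + y\<bar> \<le> K" if "\<bar>x\<bar> \<le> K" "\<bar>y\<bar> \<le> K / 3" for x y K :: real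
      using that by linarith
    ultimately show "\<bar>?d\<bar> \<le> M * s\<^sup>2"
      using w[OF s'] by blast
  qed (use t in \<open>auto intro!: continuous_intros cont\<close>)
  show ?thesis
  proof (rule abs_le_of_abs_deriv_le[where u = ?\<phi> and v = "\<lambda>t. M * t ^ 4 / 12"])
    fix s assume s: "0 < s" "s < h"
    show "(?\<phi> has_real_derivative ?\<phi>1 s) (at s)"
      by (rule derivative_eq_intros Df[OF s] refl | simp add: field_simps)+
    show "((\<lambda>t. M * t ^ 4 / 12) has_real_derivative M * s ^ 3 / 3) (at s)"
      by (auto intro!: derivative_eq_intros)
    show "\<bar>?\<phi>1 s\<bar> \<le> M * s ^ 3 / 3" by (rule \<phi>1[OF s])
  qed (use \<open>0 \<le> h\<close> in \<open>auto intro!: continuous_intros cont\<close>)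
qed

lemma quasi_convex_on_Icc_le:
  assumes "quasi_convex_on {a..b} g" "x \<in> {a..b}"
  shows "g x \<le> max (g a) (g b)"
proof -
  \<comment> \<open>The segment is taken from \<open>b\<close> to \<open>a\<close> so that its
    parameter \<open>t\<close> is the weight of \<open>a\<close>, as in
    \<open>quasi_convex_on_def\<close>.\<close>
  from assms(2) have "x \<in> closed_segment b a" "a \<le> b"
    by (auto simp: closed_segment_eq_real_ivl)
  then obtain t where "x = t * a + (1 - t) * b" "t \<in> {0..1}"
    by (auto simp: in_segment add.commute)
  with assms(1) \<open>a \<le> b\<close> show ?thesis
    unfolding quasi_convex_on_def by auto
qed

theorem theorem2p8:
  fixes f :: "real \<Rightarrow> real" and I :: "real set" and a b q :: real
  assumes "is_interval I"
    and "\<And>(k::nat) x. k < 3 \<Longrightarrow> x \<in> interior I \<Longrightarrow> (deriv ^^ k) f differentiable (at x)"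
    and "a \<in> interior I" and "b \<in> interior I" and "a < b"
    and "set_integrable lebesgue {a..b} ((deriv ^^ 3) f)"
    and "q \<ge> 1"
    and "quasi_convex_on {a..b} (\<lambda>x. \<bar>(deriv ^^ 3) f x\<bar> powr q)"
  shows "\<bar>f ((a + b) / 2) - 1 / (b - a) * (LINT x:{a..b}|lebesgue. f x)
            + (b - a) / 24 * (deriv f b - deriv f a)\<bar>
         \<le> (b - a) ^ 3 / 192 *
             (max (\<bar>(deriv ^^ 3) f a\<bar> powr q) (\<bar>(deriv ^^ 3) f b\<bar> powr q)) powr (1 / q)"
proof -
  define M where
    "M = (max (\<bar>(deriv ^^ 3) f a\<bar> powr q) (\<bar>(deriv ^^ 3) f b\<bar> powr q)) powr (1 / q)"
  define m h where "m = (a + b) / 2" and "h = (b - a) / 2"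
  have ab: "m - h = a" "m + h = b" and "0 < h"
    using \<open>a < b\<close> by (auto simp: m_def h_def field_simps)
  \<comment> \<open>Convexity puts all of \<open>{a..b}\<close> inside the interior, so derivatives
    are two-sided even at \<open>a\<close> and \<open>b\<close>.\<close>
  have "convex (interior I)"
    using assms(1) by (intro convex_interior) (simp add: is_interval_convex_1)
  then have sub: "x \<in> interior I" if "x \<in> {a..b}" for x
    using closed_segment_subset[OF assms(3,4)] that \<open>a < b\<close>
    by (auto simp: closed_segment_eq_real_ivl)
  have D: "((deriv ^^ k) f has_real_derivative (deriv ^^ Suc k) f x) (at x)"
    if "k < 3" "x \<in> {a..b}" for k x
    using assms(2)[OF that(1) sub[OF that(2)]]
    by (simp add: DERIV_deriv_iff_real_differentiable)
  have cf: "continuous_on {a..b} f"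
    using D[of 0] by (intro DERIV_continuous_on[OF has_field_derivative_at_within]) auto
  define F where "F x = integral {a..x} f" for x
  have F: "continuous_on {a..b} F"
    unfolding F_def by (intro indefinite_integral_continuous_1 integrable_continuous_real cf)
  \<comment> \<open>The fundamental theorem gives the derivative within \<open>{a..b}\<close>;
    strictly inside, this is the full derivative.\<close>
  have dF: "(F has_real_derivative f x) (at x)" if "a < x" "x < b" for x
    using integral_has_real_derivative[OF cf, of x] that at_within_Icc_at[of a x b]
    by (simp add: F_def[abs_def])
  have "set_integrable lebesgue {a..b} f"
    using borel_integrable_atLeastAtMost'[OF cf]
    by (simp add: set_integrable_def integrable_completion borel_measurable_integrable)
  then have L: "(LINT x:{a..b}|lebesgue. f x) = F b - F a"
    by (simp add: set_lebesgue_integral_eq_integral F_def)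
  have M: "\<bar>(deriv ^^ 3) f x\<bar> \<le> M" if "x \<in> {a..b}" for x
  proof -
    \<comment> \<open>Quasi-convexity bounds the \<open>q\<close>-th power by its larger endpoint
      value, and taking \<open>q\<close>-th roots is monotone.\<close>
    have "(\<bar>(deriv ^^ 3) f x\<bar> powr q) powr (1 / q) \<le> M"
      unfolding M_def using quasi_convex_on_Icc_le[OF assms(8) that] \<open>q \<ge> 1\<close>
      by (intro powr_mono2) auto
    with \<open>q \<ge> 1\<close> show ?thesis by (simp add: powr_powr)
  qed
  have "\<bar>2 * h * f m - (F (m + h) - F (m - h)) + h\<^sup>2 / 6 * (deriv f (m + h) - deriv f (m - h))\<bar>
    \<le> M * h ^ 4 / 12"
  proof (rule midpoint_remainder_bound[where ?f2.0 = "(deriv ^^ 2) f" and ?f3.0 = "(deriv ^^ 3) f"])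
    fix x assume "x \<in> {m - h..m + h}"
    then have x: "x \<in> {a..b}" by (simp only: ab)
    show "(f has_real_derivative deriv f x) (at x)" using D[of 0, OF _ x] by simp
    show "(deriv f has_real_derivative (deriv ^^ 2) f x) (at x)"
      using D[of 1, OF _ x] by (simp add: numeral_2_eq_2)
    show "((deriv ^^ 2) f has_real_derivative (deriv ^^ 3) f x) (at x)"
      using D[of 2, OF _ x] by (simp add: numeral_3_eq_3 numeral_2_eq_2)
    show "\<bar>(deriv ^^ 3) f x\<bar> \<le> M" by (rule M[OF x])
  qed (use F dF \<open>0 < h\<close> in \<open>simp_all only: ab less_imp_le\<close>)
  \<comment> \<open>Both sides of the bound are factored by \<open>2 * h = b - a\<close>, which is
    then cancelled; the constants match since 4/24 = 1/6 and 16/192 = 1/12.\<close>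
  moreover have "2 * h * f m - (F (m + h) - F (m - h)) + h\<^sup>2 / 6 * (deriv f (m + h) - deriv f (m - h))
    = 2 * h * (f m - 1 / (b - a) * (F b - F a) + (b - a) / 24 * (deriv f b - deriv f a))"
    using \<open>a < b\<close> by (simp add: ab) (simp add: h_def field_simps power2_eq_square)
  moreover have "M * h ^ 4 / 12 = 2 * h * ((b - a) ^ 3 / 192 * M)"
    by (simp add: h_def field_simps eval_nat_numeral)
  ultimately have "2 * h * \<bar>f m - 1 / (b - a) * (F b - F a) + (b - a) / 24 * (deriv f b - deriv f a)\<bar>
    \<le> 2 * h * ((b - a) ^ 3 / 192 * M)"
    using \<open>0 < h\<close> by (simp add: abs_mult)
  then show ?thesis
    using \<open>0 < h\<close> by (simp add: L M_def m_def)
qed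

end
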